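(* Let $u\in V$ be a unit vector, let $\hat u\in\hat V=\operatorname{Im}\mathbb O$ denote the corresponding unit imaginary octonion, and let $\lambda=\mu+Q\hat u\in\mathbb C_{\hat u}=\mathbb R\oplus\mathbb R\hat u$ with $\mu,Q\in\mathbb R$. Put $H_{u,Q}:=h-Q\,R_{\hat u}\in\operatorname{End}_{\mathbb R}(W)$. Then, for $\hat w\in W$, the right-eigenvalue equation $$h(\hat w)=\hat w\lambda$$ is equivalent to $$H_{u,Q}(\hat w)=\mu\hat w.$$ Equivalently, $\ker(h-R_\lambda)\neq0$ if and only if $\ker(H_{u,Q}-\mu\,\mathrm{id})\neq0$.
   Context: $\mathbb O$ is the octonion algebra. $V$ is an oriented Euclidean $7$-dimensional real vector space with a fixed isometric identification $V\cong\hat V:=\operatorname{Im}\mathbb O$, $v\mapsto\hat v$. Let $W=\mathbb O\otimes_{\mathbb R}V$. Fix an orthonormal basis $e_1,\dots,e_7$ of $V$ with corresponding basis $\hat e_1,\dots,\hat e_7$ of $\hat V$; repeated indices are summed. The real-linear operator $h:W\to W$ (independent of the basis) is $h(\hat w)=\big((\hat e_i\hat e_j)\hat w_j\big)\otimes e_i$ for $\hat w=\hat w_j\otimes e_j$, $\hat w_j\in\mathbb O$. Right multiplication on $W$ by $a\in\mathbb O$ is $R_a(x\otimes v)=(xa)\otimes v$, and $\hat w\lambda:=R_\lambda(\hat w)$. *)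

theory Defs
  imports "HOL-Analysis.Analysis" "HOL-Analysis.Finite_Function_Topology"
begin

section \<open>The octonion algebra\<close>

text \<open>
  The octonions are realised on the orthogonal sum of the real axis and the imaginary part
  \<open>real ^ 7\<close>, with product
  \<open>(a, v) (b, w) = (a b - v \<bullet> w, a w + b v + v \<times> w)\<close>. The imaginary units are indexed by the
  integers modulo 7, i.e. by the type \<open>7\<close>, whose arithmetic is used in the subscripts below. The
  seven-dimensional cross product is the one with \<open>i\<^sub>k \<times> i\<^sub>k\<^sub>+\<^sub>1 = i\<^sub>k\<^sub>+\<^sub>3\<close> and its cyclic
  permutations. The inner product and norm are those of the product type.
\<close>

type_synonym octonion = "real \<times> (real ^ 7)"

definition cross7 :: "real ^ 7 \<Rightarrow> real ^ 7 \<Rightarrow> real ^ 7" where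
  "cross7 v w = (\<chi> k.
      (v $ (k + 1) * w $ (k + 3) - v $ (k + 3) * w $ (k + 1))
    + (v $ (k + 2) * w $ (k + 6) - v $ (k + 6) * w $ (k + 2))
    + (v $ (k + 4) * w $ (k + 5) - v $ (k + 5) * w $ (k + 4)))"

definition oct_mult :: "octonion \<Rightarrow> octonion \<Rightarrow> octonion" (infixl "\<odot>" 70) where
  "x \<odot> y = (fst x * fst y - snd x \<bullet> snd y,
            fst x *\<^sub>R snd y + fst y *\<^sub>R snd x + cross7 (snd x) (snd y))"

definition oct_of_real :: "real \<Rightarrow> octonion" where
  "oct_of_real r = (r, 0)"

definition oct_imag :: "octonion set" where
  "oct_imag = {x. fst x = 0}"

lemma bilinear_oct_mult: "bilinear (\<odot>)"
  unfolding bilinear_def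
  by (auto intro!: linearI
      simp: oct_mult_def cross7_def vec_eq_iff inner_add_left inner_add_right algebra_simps)

lemmas oct_bilinear_simps =
  bilinear_ladd[OF bilinear_oct_mult] bilinear_radd[OF bilinear_oct_mult]
  bilinear_lmul[OF bilinear_oct_mult] bilinear_rmul[OF bilinear_oct_mult]

lemma linear_oct_mult_right: "linear (\<lambda>y. x \<odot> y)"
  by (simp add: bilinear_oct_mult[unfolded bilinear_def])

lemma oct_of_real_mult: "oct_of_real r \<odot> x = r *\<^sub>R x" "x \<odot> oct_of_real r = r *\<^sub>R x"
  by (cases x; simp add: oct_mult_def oct_of_real_def cross7_def vec_eq_iff)+

lemma exhaust_7: "x = 0 \<or> x = 1 \<or> x = 2 \<or> x = 3 \<or> x = 4 \<or> x = 5 \<or> x = 6" for x :: 7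
proof (induct x)
  case (of_int z)
  then have "z = 0 \<or> z = 1 \<or> z = 2 \<or> z = 3 \<or> z = 4 \<or> z = 5 \<or> z = 6" by fastforce
  then show ?case by auto
qed

lemma UNIV_7: "(UNIV :: 7 set) = {0, 1, 2, 3, 4, 5, 6}"
  using exhaust_7 by auto

lemma sum_7: "sum f (UNIV :: 7 set) = f 0 + f 1 + f 2 + f 3 + f 4 + f 5 + f 6"
  unfolding UNIV_7 by (simp add: ac_simps)

lemma reduce_mod_7:
  "(7::7) = 0" "(8::7) = 1" "(9::7) = 2" "(10::7) = 3" "(11::7) = 4" "(12::7) = 5"
  by simp_all

lemma cross7_orthogonal: "v \<bullet> cross7 v w = 0" "w \<bullet> cross7 v w = 0"
  by (simp_all add: cross7_def inner_vec_def sum_7 reduce_mod_7 algebra_simps)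

lemma cross7_inner: "cross7 v w \<bullet> cross7 v w = (v \<bullet> v) * (w \<bullet> w) - (v \<bullet> w)\<^sup>2"
  by (simp add: cross7_def inner_vec_def sum_7 reduce_mod_7)
    (simp add: algebra_simps power2_eq_square)

text \<open>
  The product is a unital composition algebra product on an eight-dimensional Euclidean space, so
  by Hurwitz's theorem it is the octonion algebra.
\<close>

lemma norm_oct_mult: "norm (x \<odot> y) = norm x * norm y"
proof -
  obtain a v b w where xy: "x = (a, v)" "y = (b, w)"
    by (metis surj_pair)
  define c where "c = cross7 v w"
  have c: "c \<bullet> v = 0" "v \<bullet> c = 0" "c \<bullet> w = 0" "w \<bullet> c = 0"
    "c \<bullet> c = (v \<bullet> v) * (w \<bullet> w) - (v \<bullet> w)\<^sup>2"
    unfolding c_def inner_commute[of "cross7 v w" v] inner_commute[of "cross7 v w" w]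
    by (rule cross7_orthogonal cross7_inner)+
  have wv: "w \<bullet> v = v \<bullet> w"
    by (rule inner_commute)
  have "(x \<odot> y) \<bullet> (x \<odot> y) = (a * b - v \<bullet> w)\<^sup>2 + (a *\<^sub>R w + b *\<^sub>R v + c) \<bullet> (a *\<^sub>R w + b *\<^sub>R v + c)"
    by (simp add: xy oct_mult_def c_def power2_eq_square)
  also have "\<dots> = (a * a + v \<bullet> v) * (b * b + w \<bullet> w)"
    unfolding inner_add_left inner_add_right inner_scaleR_left inner_scaleR_right c wv
    by (simp add: algebra_simps power2_eq_square)
  also have "\<dots> = (x \<bullet> x) * (y \<bullet> y)"
    by (simp add: xy)
  finally have "(norm (x \<odot> y))\<^sup>2 = (norm x * norm y)\<^sup>2"
    by (simp add: power_mult_distrib power2_norm_eq_inner)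
  then show ?thesis
    by (simp add: power2_eq_iff_nonneg)
qed

section \<open>Tensor products of real vector spaces\<close>

text \<open>
  The quotient of the free real vector space on \<open>'a \<times> 'b\<close> by the subspace spanned by the
  bilinearity relations.
\<close>

abbreviation free_gen :: "'a \<Rightarrow> 'b \<Rightarrow> ('a \<times> 'b) \<Rightarrow>\<^sub>0 real" where
  "free_gen x v \<equiv> Poly_Mapping.single (x, v) 1"

definition tensor_relations :: "(('a::real_vector \<times> 'b::real_vector) \<Rightarrow>\<^sub>0 real) set" where
  "tensor_relations =
     {free_gen (x + y) v - free_gen x v - free_gen y v | x y v. True}
   \<union> {free_gen x (v + w) - free_gen x v - free_gen x w | x v w. True}
   \<union> {free_gen (c *\<^sub>R x) v - c *\<^sub>R free_gen x v | c x v. True}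
   \<union> {free_gen x (c *\<^sub>R v) - c *\<^sub>R free_gen x v | c x v. True}"

definition tensor_equiv ::
  "(('a::real_vector \<times> 'b::real_vector) \<Rightarrow>\<^sub>0 real) \<Rightarrow> (('a \<times> 'b) \<Rightarrow>\<^sub>0 real) \<Rightarrow> bool" where
  "tensor_equiv p q \<longleftrightarrow> p - q \<in> span tensor_relations"

lemma equivp_tensor_equiv:
  "equivp (tensor_equiv :: (('a::real_vector \<times> 'b::real_vector) \<Rightarrow>\<^sub>0 real) \<Rightarrow> _)"
  (is "equivp ?R")
proof (rule equivpI)
  show "reflp ?R"
    by (simp add: reflp_def tensor_equiv_def span_zero)
  show "symp ?R"
    unfolding symp_def tensor_equiv_def by (metis minus_diff_eq span_neg)
  show "transp ?R"
  proof (rule transpI)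
    fix p q r :: "('a \<times> 'b) \<Rightarrow>\<^sub>0 real"
    assume "tensor_equiv p q" "tensor_equiv q r"
    then have "(p - q) + (q - r) \<in> span tensor_relations"
      unfolding tensor_equiv_def by (rule span_add)
    then show "tensor_equiv p r" by (simp add: tensor_equiv_def)
  qed
qed

quotient_type (overloaded) ('a, 'b) tensor =
  "('a::real_vector \<times> 'b::real_vector) \<Rightarrow>\<^sub>0 real" / tensor_equiv
  by (rule equivp_tensor_equiv)

instantiation tensor :: (real_vector, real_vector) real_vector
begin

lift_definition zero_tensor :: "('a, 'b) tensor" is 0 .

lift_definition plus_tensor :: "('a, 'b) tensor \<Rightarrow> ('a, 'b) tensor \<Rightarrow> ('a, 'b) tensor" is "(+)"
  unfolding tensor_equiv_def by (drule (1) span_add) (simp add: algebra_simps)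

lift_definition minus_tensor :: "('a, 'b) tensor \<Rightarrow> ('a, 'b) tensor \<Rightarrow> ('a, 'b) tensor" is "(-)"
  unfolding tensor_equiv_def by (drule (1) span_diff) (simp add: algebra_simps)

lift_definition uminus_tensor :: "('a, 'b) tensor \<Rightarrow> ('a, 'b) tensor" is uminus
  unfolding tensor_equiv_def by (drule span_neg) (simp add: algebra_simps)

lift_definition scaleR_tensor :: "real \<Rightarrow> ('a, 'b) tensor \<Rightarrow> ('a, 'b) tensor" is scaleR
  unfolding tensor_equiv_def by (simp add: span_mul flip: scaleR_right_diff_distrib)

instance
  by standard
    (transfer; simp add: tensor_equiv_def algebra_simps span_zero)+

end

lift_definition tensor :: "'a::real_vector \<Rightarrow> 'b::real_vector \<Rightarrow> ('a, 'b) tensor" (infix "\<otimes>" 75)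
  is free_gen .

lemma tensor_relation_imp_equiv: "p - q \<in> tensor_relations \<Longrightarrow> tensor_equiv p q"
  unfolding tensor_equiv_def by (rule span_base)

lemma bilinear_tensor: "bilinear (\<otimes>)"
  unfolding bilinear_def
proof (intro conjI allI linearI)
  fix x y :: 'a and v w :: 'b and c :: real
  show "x \<otimes> (v + w) = x \<otimes> v + x \<otimes> w"
  proof (transfer, rule tensor_relation_imp_equiv)
    fix x :: 'a and v w :: 'b
    show "free_gen x (v + w) - (free_gen x v + free_gen x w) \<in> tensor_relations"
      unfolding tensor_relations_def diff_diff_eq[symmetric] by blast
  qed
  show "(x + y) \<otimes> v = x \<otimes> v + y \<otimes> v"
  proof (transfer, rule tensor_relation_imp_equiv)
    fix x y :: 'a and v :: 'b
    show "free_gen (x + y) v - (free_gen x v + free_gen y v) \<in> tensor_relations"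
      unfolding tensor_relations_def diff_diff_eq[symmetric] by blast
  qed
  show "x \<otimes> (c *\<^sub>R v) = c *\<^sub>R (x \<otimes> v)"
  proof (transfer, rule tensor_relation_imp_equiv)
    fix x :: 'a and v :: 'b and c :: real
    show "free_gen x (c *\<^sub>R v) - c *\<^sub>R free_gen x v \<in> tensor_relations"
      unfolding tensor_relations_def by blast
  qed
  show "(c *\<^sub>R x) \<otimes> v = c *\<^sub>R (x \<otimes> v)"
  proof (transfer, rule tensor_relation_imp_equiv)
    fix x :: 'a and v :: 'b and c :: real
    show "free_gen (c *\<^sub>R x) v - c *\<^sub>R free_gen x v \<in> tensor_relations"
      unfolding tensor_relations_def by blast
  qed
qed

lemmas tensor_bilinear_simps =
  bilinear_ladd[OF bilinear_tensor] bilinear_radd[OF bilinear_tensor]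
  bilinear_lmul[OF bilinear_tensor] bilinear_rmul[OF bilinear_tensor]

lemma linear_tensor_left: "linear (\<lambda>x. x \<otimes> v)" and linear_tensor_right: "linear (\<lambda>v. x \<otimes> v)"
  by (simp_all add: bilinear_tensor[unfolded bilinear_def])

definition free_lift ::
  "('a \<Rightarrow> 'b \<Rightarrow> 'c::real_vector) \<Rightarrow> (('a \<times> 'b) \<Rightarrow>\<^sub>0 real) \<Rightarrow> 'c" where
  "free_lift f p = (\<Sum>k\<in>Poly_Mapping.keys p. Poly_Mapping.lookup p k *\<^sub>R f (fst k) (snd k))"

text \<open>
  The linear map induced by a bilinear map \<open>f\<close>; the representative chosen by \<open>rep_tensor\<close> is
  irrelevant by the universal property below. For \<open>f\<close> that is not bilinear the value has no meaning.
\<close>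

definition tensor_lift ::
  "('a::real_vector \<Rightarrow> 'b::real_vector \<Rightarrow> 'c::real_vector) \<Rightarrow> ('a, 'b) tensor \<Rightarrow> 'c" where
  "tensor_lift f t = free_lift f (rep_tensor t)"

lemma lookup_scaleR_poly: "Poly_Mapping.lookup (c *\<^sub>R p) k = c *\<^sub>R Poly_Mapping.lookup p k"
  for p :: "'a \<Rightarrow>\<^sub>0 real"
proof -
  have "finite {i. c *\<^sub>R Poly_Mapping.lookup p i \<noteq> 0}"
    by (rule finite_subset[OF _ finite_keys[of p]]) (auto simp: in_keys_iff)
  then show ?thesis
    unfolding scaleR_poly_mapping_def by (simp add: Abs_poly_mapping_inverse)
qed

lemma free_lift_superset:
  assumes "finite A" "Poly_Mapping.keys p \<subseteq> A"
  shows "free_lift f p = (\<Sum>k\<in>A. Poly_Mapping.lookup p k *\<^sub>R f (fst k) (snd k))"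
  unfolding free_lift_def using assms
  by (intro sum.mono_neutral_left) (auto simp: in_keys_iff)

lemma linear_free_lift: "linear (free_lift f)"
proof (rule linearI)
  fix p q :: "('a \<times> 'b) \<Rightarrow>\<^sub>0 real" and c :: real
  let ?A = "Poly_Mapping.keys p \<union> Poly_Mapping.keys q"
  have "free_lift f (p + q) = (\<Sum>k\<in>?A. Poly_Mapping.lookup (p + q) k *\<^sub>R f (fst k) (snd k))"
    by (rule free_lift_superset) (use keys_add[of p q] in auto)
  also have "\<dots> = free_lift f p + free_lift f q"
    by (simp add: lookup_add scaleR_add_left sum.distrib free_lift_superset[where A = ?A])
  finally show "free_lift f (p + q) = free_lift f p + free_lift f q" .
  have "free_lift f (c *\<^sub>R p) =
      (\<Sum>k\<in>Poly_Mapping.keys p. Poly_Mapping.lookup (c *\<^sub>R p) k *\<^sub>R f (fst k) (snd k))"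
    by (rule free_lift_superset) (auto simp: in_keys_iff lookup_scaleR_poly)
  then show "free_lift f (c *\<^sub>R p) = c *\<^sub>R free_lift f p"
    by (simp add: free_lift_def lookup_scaleR_poly scaleR_sum_right)
qed

lemma free_lift_gen: "free_lift f (free_gen x v) = f x v"
  by (simp add: free_lift_def)

lemma free_lift_cong:
  assumes "bilinear f" "tensor_equiv p q"
  shows "free_lift f p = free_lift f q"
proof -
  interpret F: linear "free_lift f" by (rule linear_free_lift)
  have "free_lift f r = 0" if "r \<in> span tensor_relations" for r
    using that
  proof (rule linear_eq_0_on_span[OF linear_free_lift, rotated])
    fix r :: "('a \<times> 'b) \<Rightarrow>\<^sub>0 real"
    assume "r \<in> tensor_relations"
    then show "free_lift f r = 0"
      using assms(1)
      by (auto simp: tensor_relations_def F.diff F.scaleR free_lift_gen bilinear_ladd bilinear_radd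
          bilinear_lmul bilinear_rmul)
  qed
  then have "free_lift f (p - q) = 0"
    using assms(2) by (simp add: tensor_equiv_def)
  then show ?thesis by (simp add: F.diff)
qed

lemma tensor_equiv_rep: "tensor_equiv (rep_tensor (abs_tensor p)) p"
  by (meson Quotient3_tensor rep_abs_rsp_left equivp_tensor_equiv equivp_reflp)

lemma tensor_lift_abs: "bilinear f \<Longrightarrow> tensor_lift f (abs_tensor p) = free_lift f p"
  unfolding tensor_lift_def by (rule free_lift_cong[OF _ tensor_equiv_rep])

lemma abs_rep_tensor: "abs_tensor (rep_tensor t) = t"
  using Quotient3_tensor by (rule Quotient3_abs_rep)

lemma linear_tensor_lift:
  assumes "bilinear f"
  shows "linear (tensor_lift f)"
proof (rule linearI)
  interpret F: linear "free_lift f" by (rule linear_free_lift)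
  fix s t :: "('a, 'b) tensor" and c :: real
  obtain p q where [simp]: "s = abs_tensor p" "t = abs_tensor q"
    by (metis abs_rep_tensor)
  show "tensor_lift f (s + t) = tensor_lift f s + tensor_lift f t"
    by (simp add: plus_tensor.abs_eq tensor_lift_abs assms F.add)
  show "tensor_lift f (c *\<^sub>R s) = c *\<^sub>R tensor_lift f s"
    by (simp add: scaleR_tensor.abs_eq tensor_lift_abs assms F.scaleR)
qed

lemma tensor_lift_tensor: "bilinear f \<Longrightarrow> tensor_lift f (x \<otimes> v) = f x v"
  by (simp add: tensor.abs_eq tensor_lift_abs free_lift_gen)

lemma linear_tensor_eqI:
  fixes F G :: "('a::real_vector, 'b::real_vector) tensor \<Rightarrow> 'c::real_vector"
  assumes "linear F" "linear G" "\<And>x v. F (x \<otimes> v) = G (x \<otimes> v)"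
  shows "F t = G t"
proof -
  interpret F: linear F by fact
  interpret G: linear G by fact
  have abs_add: "abs_tensor (p + q) = abs_tensor p + abs_tensor q"
    for p q :: "('a \<times> 'b) \<Rightarrow>\<^sub>0 real"
    by (simp add: plus_tensor.abs_eq)
  have abs_scale: "abs_tensor (c *\<^sub>R p) = c *\<^sub>R abs_tensor p"
    for c and p :: "('a \<times> 'b) \<Rightarrow>\<^sub>0 real"
    by (simp add: scaleR_tensor.abs_eq)
  have single: "Poly_Mapping.single k c = c *\<^sub>R Poly_Mapping.single k 1" for k :: "'a \<times> 'b" and c
    by (rule poly_mapping_eqI) (simp add: lookup_scaleR_poly lookup_single when_def)
  have "F (abs_tensor p) = G (abs_tensor p)" for p
  proof (induction p rule: update_induct)
    case const
    show ?case by (simp flip: zero_tensor.abs_eq add: F.zero G.zero)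
  next
    case (update p k c)
    have "Poly_Mapping.update k c p = p + Poly_Mapping.single k c"
      using update(1)
      by (intro poly_mapping_eqI)
        (auto simp: lookup_update lookup_add lookup_single when_def in_keys_iff)
    moreover have "abs_tensor (Poly_Mapping.single k c) = c *\<^sub>R (fst k \<otimes> snd k)"
      by (subst single) (simp add: abs_scale tensor.abs_eq)
    ultimately show ?case
      using update by (simp add: abs_add F.add G.add F.scaleR G.scaleR assms(3))
  qed
  then show ?thesis by (metis abs_rep_tensor)
qed

section \<open>The operators on \<open>W = O \<otimes> V\<close>\<close>

text \<open>
  \<open>'v\<close> is the Euclidean space \<open>V\<close>, with \<open>DIM('v) = 7\<close>, and \<open>hat\<close> the
  identification of \<open>V\<close> with the imaginary octonions.
\<close>

definition imag_identification :: "('v::euclidean_space \<Rightarrow> octonion) \<Rightarrow> bool" where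
  "imag_identification hat \<longleftrightarrow>
     linear hat \<and> (\<forall>v. norm (hat v) = norm v) \<and> range hat = oct_imag"

definition orthonormal_basis :: "(7 \<Rightarrow> 'v::euclidean_space) \<Rightarrow> bool" where
  "orthonormal_basis e \<longleftrightarrow> (\<forall>i j. e i \<bullet> e j = (if i = j then 1 else 0)) \<and> span (range e) = UNIV"

text \<open>For a member \<open>e j\<close> of an orthonormal basis, \<open>tensor_coord (e j) w\<close> is the octonion
  coefficient \<open>w\<^sub>j\<close> in \<open>w = (\<Sum>j. w\<^sub>j \<otimes> e j)\<close>.\<close>

definition tensor_coord :: "'v::euclidean_space \<Rightarrow> (octonion, 'v) tensor \<Rightarrow> octonion" where
  "tensor_coord b = tensor_lift (\<lambda>x v. (v \<bullet> b) *\<^sub>R x)"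

definition op_h ::
  "('v::euclidean_space \<Rightarrow> octonion) \<Rightarrow> (7 \<Rightarrow> 'v) \<Rightarrow> (octonion, 'v) tensor \<Rightarrow> (octonion, 'v) tensor"
  where
  "op_h hat e w =
     (\<Sum>i\<in>UNIV. (\<Sum>j\<in>UNIV. (hat (e i) \<odot> hat (e j)) \<odot> tensor_coord (e j) w) \<otimes> e i)"

definition right_mult :: "octonion \<Rightarrow> (octonion, 'v::euclidean_space) tensor \<Rightarrow> (octonion, 'v) tensor"
  where
  "right_mult a = tensor_lift (\<lambda>x v. (x \<odot> a) \<otimes> v)"

definition op_H ::
  "('v::euclidean_space \<Rightarrow> octonion) \<Rightarrow> (7 \<Rightarrow> 'v) \<Rightarrow> 'v \<Rightarrow> real
    \<Rightarrow> (octonion, 'v) tensor \<Rightarrow> (octonion, 'v) tensor" where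
  "op_H hat e u Q = (\<lambda>w. op_h hat e w - Q *\<^sub>R right_mult (hat u) w)"

definition ker :: "('a::real_vector \<Rightarrow> 'b::real_vector) \<Rightarrow> 'a set" where
  "ker f = {x. f x = 0}"

lemma bilinear_coord: "bilinear (\<lambda>(x::octonion) v. (v \<bullet> b) *\<^sub>R x)"
  unfolding bilinear_def
  by (intro conjI allI linearI)
    (simp_all only: inner_add_left inner_scaleR_left scaleR_add_left scaleR_add_right
      scaleR_scaleR mult.commute)

lemma bilinear_right_mult: "bilinear (\<lambda>x v. (x \<odot> a) \<otimes> v)"
  unfolding bilinear_def
  by (intro conjI allI linearI) (simp_all only: tensor_bilinear_simps oct_bilinear_simps)

lemma linear_tensor_coord: "linear (tensor_coord b)"
  unfolding tensor_coord_def by (rule linear_tensor_lift[OF bilinear_coord])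

lemma tensor_coord_tensor: "tensor_coord b (x \<otimes> v) = (v \<bullet> b) *\<^sub>R x"
  unfolding tensor_coord_def by (rule tensor_lift_tensor[OF bilinear_coord])

lemma linear_right_mult: "linear (right_mult a)"
  unfolding right_mult_def by (rule linear_tensor_lift[OF bilinear_right_mult])

lemma right_mult_tensor: "right_mult a (x \<otimes> v) = (x \<odot> a) \<otimes> v"
  unfolding right_mult_def by (rule tensor_lift_tensor[OF bilinear_right_mult])

lemma linear_op_h: "linear (op_h hat e)"
proof -
  have "linear (\<lambda>w. (hat (e i) \<odot> hat (e j)) \<odot> tensor_coord (e j) w)" for i j
    using linear_compose[OF linear_tensor_coord linear_oct_mult_right] unfolding o_def .
  then have "linear (\<lambda>w. \<Sum>j\<in>UNIV. (hat (e i) \<odot> hat (e j)) \<odot> tensor_coord (e j) w)" for i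
    by (intro linear_compose_sum ballI)
  then have "linear (\<lambda>w. (\<Sum>j\<in>UNIV. (hat (e i) \<odot> hat (e j)) \<odot> tensor_coord (e j) w) \<otimes> e i)" for i
    using linear_compose[OF _ linear_tensor_left, unfolded o_def] by fast
  then have "linear (\<lambda>w. \<Sum>i\<in>UNIV.
      (\<Sum>j\<in>UNIV. (hat (e i) \<odot> hat (e j)) \<odot> tensor_coord (e j) w) \<otimes> e i)"
    by (intro linear_compose_sum ballI)
  then show ?thesis unfolding op_h_def .
qed

lemma orthonormal_basis_expand:
  assumes "orthonormal_basis e"
  shows "(\<Sum>i\<in>UNIV. (v \<bullet> e i) *\<^sub>R e i) = v"
proof -
  have "linear (\<lambda>v. \<Sum>i\<in>UNIV. (v \<bullet> e i) *\<^sub>R e i)"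
    by (auto intro!: linearI simp: inner_add_left scaleR_add_left sum.distrib scaleR_sum_right)
  moreover have "(\<Sum>i\<in>UNIV. (e k \<bullet> e i) *\<^sub>R e i) = e k" for k
    using assms by (simp add: orthonormal_basis_def if_distrib[of "\<lambda>c. c *\<^sub>R _"] cong: if_cong)
  ultimately show ?thesis
    using linear_eq_on_span[OF _ linear_ident,
        of "\<lambda>v. \<Sum>i\<in>UNIV. (v \<bullet> e i) *\<^sub>R e i" "range e" v] assms
    unfolding orthonormal_basis_def by blast
qed

lemma tensor_coord_expand:
  assumes "orthonormal_basis e"
  shows "(\<Sum>j\<in>UNIV. tensor_coord (e j) w \<otimes> e j) = w"
proof -
  have "linear (\<lambda>w. tensor_coord (e j) w \<otimes> e j)" for j
    using linear_compose[OF linear_tensor_coord linear_tensor_left] unfolding o_def .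
  then have "linear (\<lambda>w. \<Sum>j\<in>UNIV. tensor_coord (e j) w \<otimes> e j)"
    by (intro linear_compose_sum ballI)
  moreover have "(\<Sum>j\<in>UNIV. tensor_coord (e j) (x \<otimes> v) \<otimes> e j) = x \<otimes> v" for x v
  proof -
    interpret T: linear "\<lambda>v. x \<otimes> v" by (rule linear_tensor_right)
    have "(\<Sum>j\<in>UNIV. tensor_coord (e j) (x \<otimes> v) \<otimes> e j) = x \<otimes> (\<Sum>j\<in>UNIV. (v \<bullet> e j) *\<^sub>R e j)"
      by (simp add: tensor_coord_tensor T.sum tensor_bilinear_simps)
    then show ?thesis by (simp add: orthonormal_basis_expand[OF assms])
  qed
  ultimately show ?thesis
    using linear_tensor_eqI[OF _ linear_ident] by blast
qed

lemma tensor_coord_sum: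
  assumes "orthonormal_basis e"
  shows "tensor_coord (e k) (\<Sum>j\<in>UNIV. c j \<otimes> e j) = c k"
  using assms
  by (simp add: linear_sum[OF linear_tensor_coord] tensor_coord_tensor orthonormal_basis_def
      if_distrib[of "\<lambda>r. r *\<^sub>R _"] cong: if_cong)

lemma op_h_tensor:
  assumes "orthonormal_basis e" "linear hat"
  shows "op_h hat e (x \<otimes> v) = (\<Sum>i\<in>UNIV. ((hat (e i) \<odot> hat v) \<odot> x) \<otimes> e i)"
proof -
  have "(\<Sum>j\<in>UNIV. (a \<odot> hat (e j)) \<odot> tensor_coord (e j) (x \<otimes> v)) = (a \<odot> hat v) \<odot> x" for a
  proof -
    have "linear (\<lambda>v. (a \<odot> hat v) \<odot> x)"
      by (intro linearI)
        (simp_all only: oct_bilinear_simps linear_add[OF assms(2)] linear_cmul[OF assms(2)])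
    then interpret L: linear "\<lambda>v. (a \<odot> hat v) \<odot> x" .
    have "(\<Sum>j\<in>UNIV. (a \<odot> hat (e j)) \<odot> tensor_coord (e j) (x \<otimes> v))
        = (a \<odot> hat (\<Sum>j\<in>UNIV. (v \<bullet> e j) *\<^sub>R e j)) \<odot> x"
      by (simp add: L.sum L.scaleR tensor_coord_tensor oct_bilinear_simps)
    then show ?thesis by (simp add: orthonormal_basis_expand[OF assms(1)])
  qed
  then show ?thesis unfolding op_h_def by simp
qed

lemma op_h_basis_independent:
  assumes "orthonormal_basis e" "orthonormal_basis f" "linear hat"
  shows "op_h hat e = op_h hat f"
proof
  fix w
  show "op_h hat e w = op_h hat f w"
  proof (rule linear_tensor_eqI[OF linear_op_h linear_op_h])
    fix x v
    define B where "B = (\<lambda>a b :: 'a. ((hat a \<odot> hat v) \<odot> x) \<otimes> b)"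
    have B: "bilinear B"
      unfolding B_def bilinear_def
      by (intro conjI allI linearI)
        (simp_all only: oct_bilinear_simps tensor_bilinear_simps
          linear_add[OF assms(3)] linear_cmul[OF assms(3)])
    have 1: "B (\<Sum>k\<in>UNIV. (a \<bullet> f k) *\<^sub>R f k) b = (\<Sum>k\<in>UNIV. (a \<bullet> f k) *\<^sub>R B (f k) b)" for a b
    proof -
      interpret L: linear "\<lambda>a. B a b" using B by (simp add: bilinear_def)
      show ?thesis by (simp add: L.sum L.scaleR)
    qed
    have 2: "B a (\<Sum>k\<in>UNIV. (b \<bullet> e k) *\<^sub>R e k) = (\<Sum>k\<in>UNIV. (b \<bullet> e k) *\<^sub>R B a (e k))" for a b
    proof -
      interpret L: linear "B a" using B by (simp add: bilinear_def)
      show ?thesis by (simp add: L.sum L.scaleR)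
    qed
    have "(\<Sum>i\<in>UNIV. B (e i) (e i)) = (\<Sum>i\<in>UNIV. \<Sum>k\<in>UNIV. (e i \<bullet> f k) *\<^sub>R B (f k) (e i))"
      unfolding 1[symmetric] orthonormal_basis_expand[OF assms(2)] ..
    also have "\<dots> = (\<Sum>k\<in>UNIV. \<Sum>i\<in>UNIV. (f k \<bullet> e i) *\<^sub>R B (f k) (e i))"
      by (subst sum.swap) (simp add: inner_commute)
    also have "\<dots> = (\<Sum>k\<in>UNIV. B (f k) (f k))"
      unfolding 2[symmetric] orthonormal_basis_expand[OF assms(1)] ..
    finally show "op_h hat e (x \<otimes> v) = op_h hat f (x \<otimes> v)"
      by (simp add: op_h_tensor assms B_def)
  qed
qed

end

theory Submission
  imports Defs
begin

text \<open>
  Right multiplication \<open>R\<^sub>a\<close> depends linearly on \<open>a\<close>, and a real octonion acts as a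
  scalar, so \<open>R\<^sub>\<lambda> = \<mu> id + Q R\<^bsub>hat u\<^esub>\<close> on all of \<open>W\<close>. Hence
  \<open>h - R\<^sub>\<lambda>\<close> and \<open>H\<^bsub>u,Q\<^esub> - \<mu> id\<close> are one and the same operator, and both equivalences
  only express that its kernel is the solution set of either equation. The non-associativity of
  the octonions causes no difficulty, because a single right multiplication is compared with a sum
  of such and no products of operators are formed.
\<close>

lemma right_mult_add: "right_mult (a + b) w = right_mult a w + right_mult b w"
  by (rule linear_tensor_eqI[OF linear_right_mult
        linear_compose_add[OF linear_right_mult linear_right_mult]])
    (simp only: right_mult_tensor oct_bilinear_simps tensor_bilinear_simps)

lemma right_mult_scaleR: "right_mult (c *\<^sub>R a) w = c *\<^sub>R right_mult a w"
  by (rule linear_tensor_eqI[OF linear_right_mult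
        linear_compose_scale_right[OF linear_right_mult]])
    (simp only: right_mult_tensor oct_bilinear_simps tensor_bilinear_simps)

lemma right_mult_of_real: "right_mult (oct_of_real r) w = r *\<^sub>R w"
  by (rule linear_tensor_eqI[OF linear_right_mult linear_compose_scale_right[OF linear_ident]])
    (simp only: right_mult_tensor oct_of_real_mult tensor_bilinear_simps)

lemma linear_op_H: "linear (op_H hat e u Q)"
  unfolding op_H_def
  by (intro linear_compose_sub linear_op_h linear_compose_scale_right linear_right_mult)

lemma op_h_minus_right_mult:
  "op_h hat e w - right_mult (oct_of_real \<mu> + Q *\<^sub>R hat u) w = op_H hat e u Q w - \<mu> *\<^sub>R w"
  by (simp add: op_H_def right_mult_add right_mult_scaleR right_mult_of_real)

theorem proposition5p2:
  fixes hat :: "'v::euclidean_space \<Rightarrow> octonion"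
    and e :: "7 \<Rightarrow> 'v"
    and u :: 'v
    and lam :: octonion
    and \<mu> Q :: real
  assumes "DIM('v) = 7"
    and "imag_identification hat"
    and "orthonormal_basis e"
    and "norm u = 1"
    and "lam = oct_of_real \<mu> + Q *\<^sub>R hat u"
  shows "linear (op_H hat e u Q) \<and>
    (\<forall>w. op_h hat e w = right_mult lam w \<longleftrightarrow> op_H hat e u Q w = \<mu> *\<^sub>R w) \<and>
    (ker (\<lambda>w. op_h hat e w - right_mult lam w) \<noteq> {0} \<longleftrightarrow>
      ker (\<lambda>w. op_H hat e u Q w - \<mu> *\<^sub>R w) \<noteq> {0})"
proof -
  have shifted_eq: "op_h hat e w - right_mult lam w = op_H hat e u Q w - \<mu> *\<^sub>R w" for w
    unfolding assms(5) by (rule op_h_minus_right_mult)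
  then have "op_h hat e w = right_mult lam w \<longleftrightarrow> op_H hat e u Q w = \<mu> *\<^sub>R w" for w
    by (metis right_minus_eq)
  then show ?thesis
    by (simp add: linear_op_H shifted_eq)
qed

end
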